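(* If a graph $G$ has acyclic chromatic number $k$, then $\operatorname{diam}(I(G)) \le 2k-2$.
   Context: All graphs are finite, simple and undirected. For a positive integer $k$, $[k]=\{1,\dots,k\}$. An orientation of $G$ assigns a direction to each edge of $G$. Given an orientation $\vec G$ of $G$ and a set $X\subseteq V(G)$, the inversion of $X$ is the operation that reverses the orientation of every arc with both endpoints in $X$. The inversion graph $I(G)$ has as its vertices the labeled orientations of $G$, two orientations being adjacent when one is obtained from the other by a single inversion. The inversion diameter $\operatorname{diam}(I(G))$ is the diameter of $I(G)$, i.e. the largest, over all pairs of orientations of $G$, of the minimum number of inversions transforming one into the other. A proper coloring $c:V(G)\to[k]$ is acyclic if, for every pair of distinct colors $i,j\in[k]$, the subgraph induced by the vertices of colors $i$ and $j$ is a forest. The acyclic chromatic number $\chi_a(G)$ is the minimum number $k$ (a positive integer) of colors in an acyclic coloring of $G$. *)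

theory Defs
  imports "Graph_Theory.Digraph_Component" "HOL-Library.Extended_Nat"
begin

text \<open>
  A finite simple undirected graph is a \<^locale>\<open>pair_graph\<close>: finite, loop-free,
  without parallel arcs, and with each edge \<open>{u, v}\<close> represented by the two arcs
  \<open>(u, v)\<close> and \<open>(v, u)\<close>.
\<close>

text \<open>
  The library's \<^const>\<open>forest\<close> is meant for digraphs: in a symmetric digraph it also
  counts the closed walk \<open>u, v, u\<close> as a cycle. In a simple undirected graph
  the cycles are the library's cycles of length at least 3.
\<close>

definition undirected_forest :: "('a, 'b) pre_digraph \<Rightarrow> bool" where
  "undirected_forest G \<longleftrightarrow> \<not> (\<exists>p. pre_digraph.cycle G p \<and> 3 \<le> length p)"

definition proper_coloring :: "'a pair_pre_digraph \<Rightarrow> nat \<Rightarrow> ('a \<Rightarrow> nat) \<Rightarrow> bool" where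
  "proper_coloring G k c \<longleftrightarrow>
     (\<forall>v \<in> pverts G. c v \<in> {1..k}) \<and> (\<forall>(u, v) \<in> parcs G. c u \<noteq> c v)"

definition acyclic_coloring :: "'a pair_pre_digraph \<Rightarrow> nat \<Rightarrow> ('a \<Rightarrow> nat) \<Rightarrow> bool" where
  "acyclic_coloring G k c \<longleftrightarrow> proper_coloring G k c \<and>
     (\<forall>i \<in> {1..k}. \<forall>j \<in> {1..k}. i \<noteq> j \<longrightarrow>
        undirected_forest (with_proj G \<restriction> {v \<in> pverts G. c v = i \<or> c v = j}))"

definition acyclic_chromatic_number :: "'a pair_pre_digraph \<Rightarrow> nat" where
  "acyclic_chromatic_number G = (LEAST k. 0 < k \<and> (\<exists>c. acyclic_coloring G k c))"

text \<open>An orientation is given by its set of arcs.\<close>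

definition orientations :: "'a pair_pre_digraph \<Rightarrow> 'a rel set" where
  "orientations G = {A. A \<subseteq> parcs G \<and> (\<forall>(u, v) \<in> parcs G. (u, v) \<in> A \<longleftrightarrow> (v, u) \<notin> A)}"

definition inversion :: "'a set \<Rightarrow> 'a rel \<Rightarrow> 'a rel" where
  "inversion X A = (\<lambda>(u, v). if u \<in> X \<and> v \<in> X then (v, u) else (u, v)) ` A"

definition inversion_graph :: "'a pair_pre_digraph \<Rightarrow> 'a rel pair_pre_digraph" where
  "inversion_graph G =
     \<lparr> pverts = orientations G,
       parcs = {(A, B). A \<in> orientations G \<and> B \<in> orientations G \<and> A \<noteq> B \<and>
                        (\<exists>X \<subseteq> pverts G. B = inversion X A)} \<rparr>"

text \<open>Distances are extended naturals, infinite between different components.\<close>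

definition graph_dist :: "('a, 'b) pre_digraph \<Rightarrow> 'a \<Rightarrow> 'a \<Rightarrow> enat" where
  "graph_dist G u v = (INF p \<in> {p. pre_digraph.awalk G u p v}. enat (length p))"

definition diameter :: "('a, 'b) pre_digraph \<Rightarrow> enat" where
  "diameter G = (SUP u \<in> verts G. SUP v \<in> verts G. graph_dist G u v)"


subsection \<open>Well-definedness\<close>

lemma mem_inversion_iff:
  "(u, v) \<in> inversion X A \<longleftrightarrow> (if u \<in> X \<and> v \<in> X then (v, u) \<in> A else (u, v) \<in> A)"
  unfolding inversion_def by (auto simp: image_iff split_beta Bex_def prod_eq_iff split: if_splits)

lemma inversion_inversion: "inversion X (inversion X A) = A"
  by (auto simp: mem_inversion_iff split: if_splits)

lemma parcs_sym:
  assumes "pair_graph G" "(u, v) \<in> parcs G"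
  shows "(v, u) \<in> parcs G"
proof -
  interpret pair_graph G by fact
  show ?thesis using pair_sym_arcs assms(2) by (auto simp: symmetric_def sym_def)
qed

lemma inversion_in_orientations:
  assumes "pair_graph G" "A \<in> orientations G"
  shows "inversion X A \<in> orientations G"
proof -
  have sub: "A \<subseteq> parcs G" and or: "\<And>u v. (u, v) \<in> parcs G \<Longrightarrow> (u, v) \<in> A \<longleftrightarrow> (v, u) \<notin> A"
    using assms(2) by (auto simp: orientations_def)
  have "(u, v) \<in> parcs G" if "(u, v) \<in> inversion X A" for u v
    using that sub parcs_sym[OF assms(1)] by (auto simp: mem_inversion_iff split: if_splits)
  moreover have "(u, v) \<in> inversion X A \<longleftrightarrow> (v, u) \<notin> inversion X A" if "(u, v) \<in> parcs G" for u v
    using or[OF that] by (simp add: mem_inversion_iff)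
  ultimately show ?thesis by (auto simp: orientations_def)
qed

lemma pair_graph_inversion_graph:
  assumes "pair_graph G"
  shows "pair_graph (inversion_graph G)"
proof -
  interpret pair_graph G by fact
  have fin: "finite (orientations G)"
    by (rule finite_subset[of _ "Pow (parcs G)"]) (auto simp: orientations_def pair_finite_arcs)
  moreover have "finite (parcs (inversion_graph G))"
    by (rule finite_subset[of _ "orientations G \<times> orientations G"])
      (auto simp: inversion_graph_def fin)
  moreover have "symmetric (with_proj (inversion_graph G))"
  proof -
    have "(B, A) \<in> parcs (inversion_graph G)" if "(A, B) \<in> parcs (inversion_graph G)" for A B
    proof -
      from that obtain X where "X \<subseteq> pverts G" "B = inversion X A"
        and AB: "A \<in> orientations G" "B \<in> orientations G" "A \<noteq> B"
        by (auto simp: inversion_graph_def)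
      then have "\<exists>X \<subseteq> pverts G. A = inversion X B"
        using inversion_inversion[of X A] by blast
      with AB show ?thesis by (auto simp: inversion_graph_def)
    qed
    then show ?thesis by (auto simp: symmetric_def sym_def)
  qed
  ultimately show ?thesis
    by unfold_locales (auto simp: inversion_graph_def)
qed

lemma acyclic_coloring_exists:
  assumes "pair_graph G"
  shows "\<exists>k c. 0 < k \<and> acyclic_coloring G k c"
proof -
  interpret pair_graph G by fact
  obtain f where f: "bij_betw f (pverts G) {0..<card (pverts G)}"
    using ex_bij_betw_finite_nat[OF pair_finite_verts] by blast
  let ?c = "Suc \<circ> f" and ?k = "Suc (card (pverts G))"
  have inj: "inj_on ?c (pverts G)" and lt: "\<And>v. v \<in> pverts G \<Longrightarrow> f v < card (pverts G)"
    using f by (auto simp: bij_betw_def inj_on_def)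
  have "?c u \<noteq> ?c v" if "(u, v) \<in> parcs G" for u v
    using inj_onD[OF inj, of u v] that pair_no_loops[OF that]
      arc_fst_in_verts[OF that] arc_snd_in_verts[OF that] by auto
  moreover have "?c v \<in> {1..?k}" if "v \<in> pverts G" for v
    using lt[OF that] by simp
  ultimately have "proper_coloring G ?k ?c"
    unfolding proper_coloring_def by blast
  moreover have "undirected_forest (with_proj G \<restriction> {v \<in> pverts G. ?c v = i \<or> ?c v = j})" for i j
  proof -
    let ?S = "{v \<in> pverts G. ?c v = i \<or> ?c v = j}"
    let ?H = "with_proj G \<restriction> ?S"
    interpret H: wf_digraph ?H
      by (rule wellformed_induce_subgraph)
    have "card ?S \<le> card {i, j}"
      by (rule card_inj_on_le[of ?c]) (use inj in \<open>auto simp: inj_on_def\<close>)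
    also have "\<dots> \<le> 2" by (simp add: card_insert_if)
    finally have card: "card ?S \<le> 2" .
    have fin: "finite ?S" using pair_finite_verts by simp
    have False if p: "H.cycle p" "3 \<le> length p" for p
    proof -
      obtain u where u: "H.awalk u p u" "distinct (tl (H.awalk_verts u p))"
        using p(1) unfolding H.cycle_def by blast
      have "set (H.awalk_verts u p) \<subseteq> ?S"
        using u(1) H.awalk_verts_in_verts[of u p] unfolding H.awalk_def induce_subgraph_verts
        by blast
      then have "set (tl (H.awalk_verts u p)) \<subseteq> ?S"
        by (cases "H.awalk_verts u p") auto
      from card_mono[OF fin this] have "length p \<le> card ?S"
        by (simp only: distinct_card[OF u(2)] length_tl H.length_awalk_verts diff_Suc_1)
      then show False using card p(2) by linarith
    qed
    then show ?thesis unfolding undirected_forest_def by blast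
  qed
  ultimately show ?thesis unfolding acyclic_coloring_def by blast
qed

lemma acyclic_chromatic_number_attained:
  assumes "pair_graph G"
  shows "0 < acyclic_chromatic_number G \<and> (\<exists>c. acyclic_coloring G (acyclic_chromatic_number G) c)"
  using LeastI_ex[of "\<lambda>k. 0 < k \<and> (\<exists>c. acyclic_coloring G k c)"] acyclic_coloring_exists[OF assms]
  unfolding acyclic_chromatic_number_def by blast

end

theory Submission
  imports Defs "HOL-Library.Z2"
begin

text \<open>
  A family of \<open>n\<close> vertex sets is the same thing as an assignment of a vector
  \<open>x v\<close> over the two-element field, of dimension \<open>n\<close>, to every vertex \<open>v\<close>: each
  coordinate records membership in one of the sets. Inverting all the sets flips
  exactly the edges \<open>uv\<close> with \<open>x u \<bullet> x v = 1\<close>. So it is enough to realize every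
  symmetric \<open>t\<close> on the edges as \<open>x u \<bullet> x v\<close> in dimension \<open>2 * k - 2\<close>
  (\<open>diameter_inversion_graph_le\<close>).

  Split the coordinates into \<open>k - 1\<close> pairs and let \<open>W\<close> be the subspace of vectors
  whose two entries agree in each pair. Over the two-element field \<open>W\<close> is orthogonal
  to itself. A vertex \<open>v\<close> gets the vector \<open>x v = a (c v) + w v\<close>, with a fixed vector
  \<open>a i\<close> for every color \<open>i\<close> and a free part \<open>w v\<close> in \<open>W\<close>. As \<open>w u \<bullet> w v = 0\<close>,
  for \<open>u\<close> of color \<open>i\<close> and \<open>v\<close> of color \<open>j\<close>
  \<open>x u \<bullet> x v = a i \<bullet> a j + a j \<bullet> w u + a i \<bullet> w v\<close>.
  Up to a constant this is a sum of a number attached to \<open>u\<close> and one attached to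
  \<open>v\<close>, and two facts finish the proof.

  Such a sum can take arbitrary values on the edges between colors \<open>i\<close> and \<open>j\<close>,
  because these edges form a forest (\<open>forest_potential\<close>).

  The numbers \<open>a j \<bullet> w u\<close> can be prescribed for all \<open>j \<noteq> i\<close> at once. For this the
  \<open>k\<close> functionals that the \<open>a j\<close> induce on the \<open>(k - 1)\<close>-dimensional space \<open>W\<close>
  have to be in general position, any \<open>k - 1\<close> of them being independent: the
  coordinate functionals together with their sum
  (\<open>color_functionals_independent\<close>).
\<close>

section \<open>Potentials on forests\<close>

lemma awalk_of_rtrancl:
  assumes "wf_digraph H" "tail H = fst" "head H = snd" "F \<subseteq> arcs H"
    and "(u, v) \<in> F\<^sup>*" "u \<in> verts H"
  shows "\<exists>p. pre_digraph.awalk H u p v \<and> set p \<subseteq> F"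
proof -
  interpret wf_digraph H by fact
  from assms(5) show ?thesis
  proof (induction rule: rtrancl_induct)
    case base
    then show ?case using assms(6) by (auto simp: awalk_Nil_iff intro!: exI[of _ "[]"])
  next
    case (step v w)
    then obtain p where p: "awalk u p v" "set p \<subseteq> F" by blast
    have "(v, w) \<in> arcs H" using step assms(4) by blast
    then have "awalk v [(v, w)] w"
      using arc_implies_awalk[of "(v, w)"] assms(2,3) by simp
    with p(1) have "awalk u (p @ [(v, w)]) w" by (rule awalk_appendI)
    with p(2) step show ?case by (intro exI[of _ "p @ [(v, w)]"]) auto
  qed
qed

text \<open>
  A path from \<open>u\<close> to \<open>v\<close> that avoids the arc \<open>(u, v)\<close> has length at least 2, so
  that closing it with \<open>(v, u)\<close> gives a cycle of the length that forests exclude.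
\<close>

lemma forest_edge_separates:
  assumes "wf_digraph H" "tail H = fst" "head H = snd" "F \<subseteq> arcs H"
    and forest: "undirected_forest H"
    and vu: "(v, u) \<in> arcs H" and "(u, v) \<notin> F" "u \<noteq> v"
  shows "(u, v) \<notin> F\<^sup>*"
proof
  assume uv: "(u, v) \<in> F\<^sup>*"
  interpret wf_digraph H by fact
  have "u \<in> verts H" using head_in_verts[OF vu] assms(3) by simp
  from awalk_of_rtrancl[OF assms(1-4) uv this]
  obtain q where q: "awalk u q v" "set q \<subseteq> F" by blast
  define p where "p = awalk_to_apath q"
  have p: "apath u p v" and pF: "set p \<subseteq> F"
    using apath_awalk_to_apath[OF q(1)] awalk_to_apath_subset[OF q(1)] q(2)
    by (auto simp: p_def)
  have aw: "awalk u p v" and dist: "distinct (awalk_verts u p)"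
    using p by (auto simp: apath_def)
  have "p \<noteq> []" using aw \<open>u \<noteq> v\<close> by (auto simp: awalk_Nil_iff)
  moreover have "p \<noteq> [e]" for e
  proof
    assume "p = [e]"
    with aw have "e = (u, v)" by (auto simp: awalk_simps assms(2,3) prod_eq_iff)
    with \<open>p = [e]\<close> pF \<open>(u, v) \<notin> F\<close> show False by simp
  qed
  ultimately have "2 \<le> length p"
    by (cases p; cases "tl p") auto
  moreover have "cycle ((v, u) # p)"
    unfolding cycle_def using aw dist vu
    by (auto simp: awalk_Cons_iff assms(2,3))
  ultimately show False
    using forest unfolding undirected_forest_def by fastforce
qed

lemma bit_add_same_cancel: "(a + d) + (b + d) = a + (b :: bit)"
  by (cases a; cases b; cases d) simp_all

text \<open>
  Remove an edge \<open>uv\<close> and take a potential for the rest. If it is wrong on \<open>uv\<close>,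
  flip it on the whole component of \<open>u\<close>: this changes no sum along a remaining edge,
  and \<open>v\<close> lies in another component. The arc set \<open>F\<close> shrinks while the host graph
  \<open>H\<close> stays fixed, so acyclicity is not transferred to subgraphs.
\<close>

lemma forest_potential:
  fixes t :: "'a \<Rightarrow> 'a \<Rightarrow> bit"
  assumes H: "wf_digraph H" "tail H = fst" "head H = snd"
    and forest: "undirected_forest H"
    and "finite F" "F \<subseteq> arcs H" "sym F" "irrefl F"
    and t: "\<And>u v. t u v = t v u"
  shows "\<exists>f. \<forall>(u, v) \<in> F. f u + f v = t u v"
  using assms(5-8)
proof (induction F rule: finite_psubset_induct)
  case (psubset F)
  show ?case
  proof (cases "F = {}")
    case False
    then obtain u v where uv: "(u, v) \<in> F" by fastforce
    then have vu: "(v, u) \<in> F" and ne: "u \<noteq> v"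
      using psubset.prems by (auto simp: sym_def irrefl_def)
    define F' where "F' = F - {(u, v), (v, u)}"
    have sym': "sym F'" using psubset.prems unfolding F'_def sym_def by blast
    have "F' \<subset> F" using uv by (auto simp: F'_def)
    moreover have "F' \<subseteq> arcs H" "irrefl F'"
      using psubset.prems by (auto simp: F'_def irrefl_def)
    ultimately obtain f where f: "\<And>a b. (a, b) \<in> F' \<Longrightarrow> f a + f b = t a b"
      using psubset.IH[of F'] sym' by blast
    define C where "C = {w. (u, w) \<in> F'\<^sup>*}"
    have "u \<in> C" by (simp add: C_def)
    have "v \<notin> C"
      using forest_edge_separates[OF H _ forest, of F' v u] psubset.prems vu ne
      by (auto simp: F'_def C_def)
    have closed: "a \<in> C \<longleftrightarrow> b \<in> C" if "(a, b) \<in> F'" for a b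
      using that symD[OF sym' that] unfolding C_def
      by (auto intro: rtrancl_into_rtrancl)
    \<comment> \<open>The added constant is \<open>1\<close> exactly when \<open>f\<close> is wrong on the edge \<open>uv\<close>.\<close>
    define g where "g w = f w + (if w \<in> C then f u + f v + t u v else 0)" for w
    have guv: "g u + g v = t u v"
      using \<open>u \<in> C\<close> \<open>v \<notin> C\<close> by (cases "f u"; cases "f v") (simp_all add: g_def)
    have "g a + g b = t a b" if "(a, b) \<in> F" for a b
    proof (cases "(a, b) \<in> F'")
      case True
      have "g a + g b = f a + f b"
        unfolding g_def closed[OF True] by (rule bit_add_same_cancel)
      then show ?thesis using f[OF True] by simp
    next
      case False
      then have "(a, b) = (u, v) \<or> (a, b) = (v, u)" using that by (auto simp: F'_def)
      then show ?thesis using guv t[of u v] by (auto simp: ac_simps)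
    qed
    then show ?thesis by blast
  qed simp
qed

section \<open>Sequences of inversions\<close>

lemma fold_inversion_in_orientations:
  assumes "pair_graph G" "A \<in> orientations G"
  shows "fold inversion Xs A \<in> orientations G"
  using assms(2) by (induction Xs arbitrary: A) (auto intro: inversion_in_orientations[OF assms(1)])

lemma mem_fold_inversion_iff:
  "(u, v) \<in> fold inversion Xs A \<longleftrightarrow>
     (if (\<Sum>X\<leftarrow>Xs. of_bool (u \<in> X \<and> v \<in> X)) = (1 :: bit) then (v, u) \<in> A else (u, v) \<in> A)"
proof (induction Xs arbitrary: A)
  case (Cons X Xs)
  let ?s = "\<Sum>X\<leftarrow>Xs. of_bool (u \<in> X \<and> v \<in> X) :: bit"
  show ?case by (cases "?s") (auto simp: Cons.IH mem_inversion_iff)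
qed simp

text \<open>
  The inversion graph has no loops, so an inversion that changes nothing is no step of
  the walk. The length is therefore only bounded by the number of inversions.
\<close>

lemma awalk_fold_inversion:
  assumes "pair_graph G" "A \<in> orientations G" "\<forall>X \<in> set Xs. X \<subseteq> pverts G"
  shows "\<exists>p. pre_digraph.awalk (with_proj (inversion_graph G)) A p (fold inversion Xs A)
             \<and> length p \<le> length Xs"
proof -
  interpret I: pair_graph "inversion_graph G"
    by (rule pair_graph_inversion_graph) fact
  show ?thesis using assms(2,3)
  proof (induction Xs arbitrary: A)
    case Nil
    then have "A \<in> pverts (inversion_graph G)" by (simp add: inversion_graph_def)
    then show ?case
      by (auto simp: I.awalk_Nil_iff intro!: exI[of _ "[]"])
  next
    case (Cons X Xs)
    let ?B = "inversion X A"
    have B: "?B \<in> orientations G"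
      by (rule inversion_in_orientations[OF assms(1) Cons.prems(1)])
    from Cons.IH[OF B] Cons.prems(2) obtain p
      where p: "I.awalk ?B p (fold inversion Xs ?B)" "length p \<le> length Xs"
      by auto
    show ?case
    proof (cases "A = ?B")
      case True
      then show ?thesis using p by (intro exI[of _ p]) auto
    next
      case False
      then have "(A, ?B) \<in> parcs (inversion_graph G)"
        using Cons.prems B by (auto simp: inversion_graph_def)
      then have "I.awalk A ((A, ?B) # p) (fold inversion (X # Xs) A)"
        using p(1) by (simp add: I.awalk_Cons_iff)
      with p(2) show ?thesis by (intro exI[of _ "(A, ?B) # p"]) auto
    qed
  qed
qed

text \<open>
  To move from an orientation \<open>A\<close> to an orientation \<open>B\<close>, apply the hypothesis to the
  indicator \<open>t\<close> of the edges that \<open>A\<close> and \<open>B\<close> direct differently. The sum in the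
  hypothesis is the scalar product of the membership vectors of \<open>u\<close> and \<open>v\<close>.
\<close>

lemma diameter_inversion_graph_le:
  assumes "pair_graph G"
    and realize: "\<And>t :: 'a \<Rightarrow> 'a \<Rightarrow> bit. (\<And>u v. t u v = t v u) \<Longrightarrow>
      \<exists>Xs. length Xs \<le> n \<and> (\<forall>X \<in> set Xs. X \<subseteq> pverts G) \<and>
        (\<forall>(u, v) \<in> parcs G. (\<Sum>X\<leftarrow>Xs. of_bool (u \<in> X \<and> v \<in> X)) = t u v)"
  shows "diameter (with_proj (inversion_graph G)) \<le> enat n"
  unfolding diameter_def
proof (intro SUP_least)
  let ?I = "with_proj (inversion_graph G)"
  fix A B assume "A \<in> verts ?I" "B \<in> verts ?I"
  then have A: "A \<in> orientations G" and B: "B \<in> orientations G"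
    by (simp_all add: inversion_graph_def)
  define t :: "'a \<Rightarrow> 'a \<Rightarrow> bit" where
    "t u v = of_bool ((u, v) \<in> A \<and> (v, u) \<in> B \<or> (v, u) \<in> A \<and> (u, v) \<in> B)" for u v
  have "t u v = t v u" for u v unfolding t_def by (intro arg_cong[of _ _ of_bool]) blast
  then have "\<exists>Xs. length Xs \<le> n \<and> (\<forall>X \<in> set Xs. X \<subseteq> pverts G) \<and>
        (\<forall>(u, v) \<in> parcs G. (\<Sum>X\<leftarrow>Xs. of_bool (u \<in> X \<and> v \<in> X)) = t u v)"
    by (rule realize)
  then obtain Xs where Xs: "length Xs \<le> n" "\<forall>X \<in> set Xs. X \<subseteq> pverts G"
    and all: "\<forall>(u, v) \<in> parcs G. (\<Sum>X\<leftarrow>Xs. of_bool (u \<in> X \<and> v \<in> X)) = t u v"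
    by (elim exE conjE)
  have sum: "(\<Sum>X\<leftarrow>Xs. of_bool (u \<in> X \<and> v \<in> X)) = t u v" if "(u, v) \<in> parcs G" for u v
    using case_prodD[OF bspec[OF all that]] .
  have orient: "C \<subseteq> parcs G" "\<And>u v. (u, v) \<in> parcs G \<Longrightarrow> (u, v) \<in> C \<longleftrightarrow> (v, u) \<notin> C"
    if "C \<in> orientations G" for C
    using that by (auto simp: orientations_def)
  let ?C = "fold inversion Xs A"
  have C: "?C \<in> orientations G" by (rule fold_inversion_in_orientations[OF assms(1) A])
  have "(u, v) \<in> ?C \<longleftrightarrow> (u, v) \<in> B" for u v
  proof (cases "(u, v) \<in> parcs G")
    case True
    show ?thesis
      using orient(2)[OF A True] orient(2)[OF B True] sum[OF True]
      by (auto simp: mem_fold_inversion_iff t_def)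
  next
    case False
    then show ?thesis using orient(1)[OF B] orient(1)[OF C] by blast
  qed
  then have "?C = B" by auto
  with awalk_fold_inversion[OF assms(1) A Xs(2)] obtain p
    where p: "pre_digraph.awalk ?I A p B" "length p \<le> length Xs" by auto
  have "graph_dist ?I A B \<le> enat (length p)"
    unfolding graph_dist_def using p(1) by (intro INF_lower) simp
  also have "\<dots> \<le> enat n" using p(2) Xs(1) by simp
  finally show "graph_dist ?I A B \<le> enat n" .
qed

section \<open>Functionals in general position\<close>

text \<open>
  The \<open>m\<close>-th coefficient of the \<open>j\<close>-th functional on vectors indexed by
  \<open>{1..<k}\<close>: the \<open>j\<close>-th unit vector for \<open>j < k\<close>, and the all-ones vector for
  \<open>j = k\<close>.
\<close>

definition color_functional :: "nat \<Rightarrow> nat \<Rightarrow> nat \<Rightarrow> bit" where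
  "color_functional k j m = of_bool (j = m \<or> j = k)"

text \<open>
  Omitting the last functional leaves the coordinates. Omitting another one, \<open>i\<close>,
  prescribes all coordinates but the \<open>i\<close>-th, which is then determined by the
  prescribed total.
\<close>

lemma color_functionals_independent:
  assumes "i \<in> {1..k}"
  shows "\<exists>y. \<forall>j \<in> {1..k} - {i}. (\<Sum>m = 1..<k. color_functional k j m * y m) = h j"
proof -
  have last: "(\<Sum>m = 1..<k. color_functional k k m * y m) = (\<Sum>m = 1..<k. y m)" for y
    unfolding color_functional_def by (intro sum.cong) auto
  have single: "(\<Sum>m = 1..<k. color_functional k j m * y m) = y j" if "j \<in> {1..<k}" for y j
  proof -
    have "(\<Sum>m = 1..<k. color_functional k j m * y m) = (\<Sum>m = 1..<k. if m = j then y m else 0)"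
      using that by (intro sum.cong) (auto simp: color_functional_def)
    then show ?thesis using that by simp
  qed
  show ?thesis
  proof (cases "i = k")
    case True
    then show ?thesis by (intro exI[of _ h] ballI single) auto
  next
    case False
    then have i: "i \<in> {1..<k}" using assms by auto
    define s where "s = (\<Sum>m \<in> {1..<k} - {i}. h m)"
    define y where "y = h(i := h k + s)"
    have "(\<Sum>m = 1..<k. y m) = y i + (\<Sum>m \<in> {1..<k} - {i}. y m)"
      using i by (intro sum.remove) auto
    also have "(\<Sum>m \<in> {1..<k} - {i}. y m) = s"
      unfolding s_def by (intro sum.cong) (auto simp: y_def)
    also have "y i + s = h k"
      by (cases s) (simp_all add: y_def)
    finally have sum: "(\<Sum>m = 1..<k. y m) = h k" .
    have "(\<Sum>m = 1..<k. color_functional k j m * y m) = h j" if "j \<in> {1..k} - {i}" for j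
    proof (cases "j = k")
      case True
      then show ?thesis using last sum by simp
    next
      case False
      then have "j \<in> {1..<k}" "j \<noteq> i" using that by auto
      then show ?thesis using single[of j y] by (simp add: y_def)
    qed
    then show ?thesis by blast
  qed
qed

section \<open>Vectors from an acyclic coloring\<close>

text \<open>
  A vertex needs a separate potential for every other color, since only the edges
  between two fixed colors form a forest. The value \<open>g u j\<close> is the potential of \<open>u\<close>
  in the forest on colors \<open>c u\<close> and \<open>j\<close>.
\<close>

lemma acyclic_coloring_potentials:
  fixes t :: "'a \<Rightarrow> 'a \<Rightarrow> bit"
  assumes "pair_graph G" and col: "acyclic_coloring G k c" and t: "\<And>u v. t u v = t v u"
  shows "\<exists>g. \<forall>(u, v) \<in> parcs G. g u (c v) + g v (c u) = t u v"
proof -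
  interpret pair_graph G by fact
  have c: "c v \<in> {1..k}" if "v \<in> pverts G" for v
    using col that by (auto simp: acyclic_coloring_def proper_coloring_def)
  have proper: "c u \<noteq> c v" if "(u, v) \<in> parcs G" for u v
    using col that by (auto simp: acyclic_coloring_def proper_coloring_def)
  define solves where "solves i j f \<longleftrightarrow> (\<forall>(u, v) \<in> parcs G.
    c u \<in> {i, j} \<and> c v \<in> {i, j} \<longrightarrow> f u + f v = t u v)" for i j f
  have "\<exists>f. solves i j f"
    if ij: "i \<in> {1..k}" "j \<in> {1..k}" "i \<noteq> j" for i j
  proof -
    let ?H = "with_proj G \<restriction> {v \<in> pverts G. c v = i \<or> c v = j}"
    have "sym (arcs ?H)" using parcs_sym[OF assms(1)] by (auto simp: sym_def)
    moreover have "irrefl (arcs ?H)" using pair_no_loops unfolding irrefl_def by fastforce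
    moreover have "finite (arcs ?H)" using pair_finite_arcs by simp
    moreover have "undirected_forest ?H"
      using col ij by (simp add: acyclic_coloring_def)
    ultimately obtain f where f: "\<forall>(u, v) \<in> arcs ?H. f u + f v = t u v"
      using forest_potential[of ?H "arcs ?H" t] wellformed_induce_subgraph t by auto
    have "f u + f v = t u v" if "(u, v) \<in> parcs G" "c u \<in> {i, j}" "c v \<in> {i, j}" for u v
    proof -
      have "(u, v) \<in> arcs ?H"
        using that arc_fst_in_verts[OF that(1)] arc_snd_in_verts[OF that(1)] by auto
      with f show ?thesis by blast
    qed
    then show ?thesis unfolding solves_def by blast
  qed
  then obtain f where "\<And>i j. \<lbrakk>i \<in> {1..k}; j \<in> {1..k}; i \<noteq> j\<rbrakk> \<Longrightarrow> solves i j (f i j)"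
    by metis
  then have f: "\<And>i j u v. \<lbrakk>i \<in> {1..k}; j \<in> {1..k}; i \<noteq> j; (u, v) \<in> parcs G;
      c u \<in> {i, j}; c v \<in> {i, j}\<rbrakk> \<Longrightarrow> f i j u + f i j v = t u v"
    unfolding solves_def by blast
  \<comment> \<open>Both ends of an edge must use the same potential of their color pair, hence the ordering.\<close>
  define g where "g u j = f (min (c u) j) (max (c u) j) u" for u j
  have "g u (c v) + g v (c u) = t u v" if e: "(u, v) \<in> parcs G" for u v
    unfolding g_def min.commute[of "c v"] max.commute[of "c v"]
    by (rule f)
      (use e proper[OF e] c[of u] c[of v] arc_fst_in_verts[OF e] arc_snd_in_verts[OF e]
        in \<open>auto simp: min_def max_def\<close>)
  then show ?thesis by blast
qed

lemma of_bool_bit_eq_one: "of_bool (a = (1::bit) \<and> b = 1) = a * b"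
  by (cases a; cases b) simp_all

text \<open>
  The contribution of one pair of coordinates to \<open>x u \<bullet> x v\<close>, with entries
  \<open>y, y + a\<close> for \<open>u\<close> and \<open>z, z + b\<close> for \<open>v\<close>. The products \<open>y * z\<close> of the free
  parts cancel.
\<close>

lemma shifted_product: "y * z + (y + a) * (z + b) = a * z + b * y + a * (b::bit)"
  by (cases y; cases z; cases a; cases b) simp_all

lemma acyclic_coloring_realizes:
  fixes t :: "'a \<Rightarrow> 'a \<Rightarrow> bit"
  assumes G: "pair_graph G" and col: "acyclic_coloring G k c" and t: "\<And>u v. t u v = t v u"
  shows "\<exists>Xs. length Xs \<le> 2 * k - 2 \<and> (\<forall>X \<in> set Xs. X \<subseteq> pverts G) \<and>
    (\<forall>(u, v) \<in> parcs G. (\<Sum>X\<leftarrow>Xs. of_bool (u \<in> X \<and> v \<in> X)) = t u v)"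
proof -
  interpret pair_graph G by fact
  have c: "c v \<in> {1..k}" if "v \<in> pverts G" for v
    using col that by (auto simp: acyclic_coloring_def proper_coloring_def)
  have proper: "c u \<noteq> c v" if "(u, v) \<in> parcs G" for u v
    using col that by (auto simp: acyclic_coloring_def proper_coloring_def)
  let ?a = "\<lambda>v. color_functional k (c v)"
  \<comment> \<open>The constants \<open>a i \<bullet> a j\<close> are absorbed into the prescribed values.\<close>
  define t' where "t' u v = t u v + (\<Sum>m = 1..<k. ?a u m * ?a v m)" for u v
  have "t' u v = t' v u" for u v
    unfolding t'_def by (intro arg_cong2[of _ _ _ _ "(+)"] sum.cong t refl mult.commute)
  from acyclic_coloring_potentials[OF G col, of t', OF this]
  obtain g where g: "\<And>u v. (u, v) \<in> parcs G \<Longrightarrow> g u (c v) + g v (c u) = t' u v"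
    by blast
  have "\<forall>u \<in> pverts G. \<exists>y. \<forall>j \<in> {1..k} - {c u}.
      (\<Sum>m = 1..<k. color_functional k j m * y m) = g u j"
    using color_functionals_independent c by blast
  then obtain y where y: "\<And>u j. \<lbrakk>u \<in> pverts G; j \<in> {1..k} - {c u}\<rbrakk> \<Longrightarrow>
      (\<Sum>m = 1..<k. color_functional k j m * y u m) = g u j"
    by (metis bchoice)
  \<comment> \<open>The coordinate pair \<open>m\<close> of \<open>v\<close> is \<open>(y v m, y v m + ?a v m)\<close>, and only its second
      entry contains the fixed part.\<close>
  define Y where "Y m = {v \<in> pverts G. y v m = 1}" for m
  define Z where "Z m = {v \<in> pverts G. y v m + ?a v m = 1}" for m
  define Xs where "Xs = map Y [1..<k] @ map Z [1..<k]"
  have "(\<Sum>X\<leftarrow>Xs. of_bool (u \<in> X \<and> v \<in> X)) = t u v" if e: "(u, v) \<in> parcs G" for u v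
  proof -
    have V: "u \<in> pverts G" "v \<in> pverts G"
      using arc_fst_in_verts[OF e] arc_snd_in_verts[OF e] by simp_all
    have "(\<Sum>X\<leftarrow>Xs. of_bool (u \<in> X \<and> v \<in> X)) =
        (\<Sum>m = 1..<k. y u m * y v m + (y u m + ?a u m) * (y v m + ?a v m))"
      unfolding Xs_def Y_def Z_def map_append sum_list_append map_map comp_def sum.distrib
        mem_Collect_eq simp_thms of_bool_bit_eq_one
      by (simp only: interv_sum_list_conv_sum_set_nat V simp_thms of_bool_bit_eq_one set_upt)
    also have "\<dots> = (\<Sum>m = 1..<k. ?a u m * y v m) + (\<Sum>m = 1..<k. ?a v m * y u m)
        + (\<Sum>m = 1..<k. ?a u m * ?a v m)"
      by (simp only: shifted_product sum.distrib)
    also have "(\<Sum>m = 1..<k. ?a u m * y v m) = g v (c u)"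
      using y[of v "c u"] V c proper[OF e] by auto
    also have "(\<Sum>m = 1..<k. ?a v m * y u m) = g u (c v)"
      using y[of u "c v"] V c proper[OF e] by auto
    also have "g v (c u) + g u (c v) = t' u v"
      using g[OF e] by (subst add.commute)
    also have "t' u v + (\<Sum>m = 1..<k. ?a u m * ?a v m) = t u v"
      unfolding t'_def by (cases "\<Sum>m = 1..<k. ?a u m * ?a v m") simp_all
    finally show ?thesis .
  qed
  moreover have "length Xs \<le> 2 * k - 2" by (simp add: Xs_def)
  moreover have "\<forall>X \<in> set Xs. X \<subseteq> pverts G" by (auto simp: Xs_def Y_def Z_def)
  ultimately show ?thesis by blast
qed

theorem theorem1p1:
  fixes G :: "'a pair_pre_digraph" and k :: nat
  assumes "pair_graph G"
    and "acyclic_chromatic_number G = k"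
  shows "diameter (with_proj (inversion_graph G)) \<le> enat (2 * k - 2)"
proof -
  obtain c where "acyclic_coloring G k c"
    using acyclic_chromatic_number_attained[OF assms(1)] assms(2) by blast
  with assms(1) show ?thesis
    by (intro diameter_inversion_graph_le acyclic_coloring_realizes)
qed

end
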